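(* Let $\Lambda=(\lambda_1,\ldots,\lambda_d)$ be a tuple of positive real essential weights. Then $\Lambda$ is an optimal hyperplane cover of an extremal $d$-dimensional $(0,1)$-matrix $A=A(\Lambda)$ of order $2$ and of diversity $1$ (i.e. $\lambda_1=\cdots=\lambda_d$) if and only if $d$ is odd and $\lambda_i=\frac{2}{d+1}$ for all $i=1,\ldots,d$.
   Context: A $d$-dimensional $(0,1)$-matrix of order $2$ is an array $A=(a_\alpha)_{\alpha\in\{0,1\}^d}$ with $a_\alpha\in\{0,1\}$; its support is the set of $\alpha$ with $a_\alpha=1$. The hyperplanes are $\Gamma_{i,j}=\{\alpha:\alpha_i=j\}$, $1\le i\le d$, $j\in\{0,1\}$. Matrices are considered up to equivalence (permutations of parallel hyperplanes, i.e. those with the same $i$, and permutations of directions). A polydiagonal in $A$ is an assignment of nonnegative real weights to the entries of the support of $A$ such that the sum of the weights over each hyperplane equals $1$. $A$ is extremal if $A$ has no polydiagonal, and after adding any new index to the support of $A$ the resulting matrix has a polydiagonal. A hyperplane cover of $A$ is a table $(\lambda_{i,j})$ of nonnegative real weights such that $\sum_{(i,j):\,\alpha\in\Gamma_{i,j}}\lambda_{i,j}\ge 1$ for every $\alpha$ in the support of $A$; its weight is the sum of all $\lambda_{i,j}$, and it is optimal if its weight is minimum among all hyperplane covers of $A$. For extremal matrices of order $2$, in an optimal cover one of the two parallel hyperplanes of each direction has weight zero, so a cover is written as a tuple $\Lambda=(\lambda_1,\ldots,\lambda_d)$ of essential weights: for each direction $i$, weight $\lambda_i$ is assigned to one of the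 two hyperplanes (up to equivalence, $\Gamma_{i,1}$) and weight $0$ to the other. Essential weights are always assumed positive. The matrix $A(\Lambda)$ is given by $a_\alpha=1\iff\sum_{i:\,\alpha_i=1}\lambda_i\ge 1$. An extremal matrix of order $2$ has diversity $m$ if its optimal hyperplane cover $\Lambda$ consists of exactly $m$ different positive real numbers. *)

theory Defs
  imports Complex_Main "HOL-Library.Cardinality"
begin

text \<open>
  The directions are the elements of a finite type \<open>'d\<close>, so the dimension is \<open>CARD('d)\<close> and is
  at least 1. In the two coordinates of an index and in the entries of a (0,1)-matrix,
  \<open>True\<close> stands for 1 and \<open>False\<close> for 0.
\<close>

type_synonym 'd index = "'d \<Rightarrow> bool"
type_synonym 'd matrix = "'d index \<Rightarrow> bool"

definition support :: "'d matrix \<Rightarrow> 'd index set" where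
  "support A = {\<alpha>. A \<alpha>}"

definition hyperplane :: "'d \<Rightarrow> bool \<Rightarrow> 'd index set" where
  "hyperplane i j = {\<alpha>. \<alpha> i = j}"

text \<open>A weighting of the support is extended by 0 to all indices.\<close>

definition polydiagonal :: "'d::finite matrix \<Rightarrow> ('d index \<Rightarrow> real) \<Rightarrow> bool" where
  "polydiagonal A w \<longleftrightarrow>
     (\<forall>\<alpha>. 0 \<le> w \<alpha>) \<and> (\<forall>\<alpha>. \<alpha> \<notin> support A \<longrightarrow> w \<alpha> = 0) \<and>
     (\<forall>i j. (\<Sum>\<alpha>\<in>hyperplane i j. w \<alpha>) = 1)"

definition extremal :: "'d::finite matrix \<Rightarrow> bool" where
  "extremal A \<longleftrightarrow>
     (\<nexists>w. polydiagonal A w) \<and>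
     (\<forall>\<beta>. \<beta> \<notin> support A \<longrightarrow> (\<exists>w. polydiagonal (A(\<beta> := True)) w))"

definition hyperplane_cover :: "'d::finite matrix \<Rightarrow> ('d \<Rightarrow> bool \<Rightarrow> real) \<Rightarrow> bool" where
  "hyperplane_cover A L \<longleftrightarrow>
     (\<forall>i j. 0 \<le> L i j) \<and>
     (\<forall>\<alpha>\<in>support A. 1 \<le> (\<Sum>(i, j)\<in>{(i, j). \<alpha> \<in> hyperplane i j}. L i j))"

definition cover_weight :: "('d::finite \<Rightarrow> bool \<Rightarrow> real) \<Rightarrow> real" where
  "cover_weight L = (\<Sum>i\<in>UNIV. \<Sum>j\<in>UNIV. L i j)"

definition optimal_cover :: "'d::finite matrix \<Rightarrow> ('d \<Rightarrow> bool \<Rightarrow> real) \<Rightarrow> bool" where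
  "optimal_cover A L \<longleftrightarrow>
     hyperplane_cover A L \<and> (\<forall>L'. hyperplane_cover A L' \<longrightarrow> cover_weight L \<le> cover_weight L')"

text \<open>
  Up to equivalence, the essential weight of direction \<open>i\<close> sits on \<open>hyperplane i True\<close>.
\<close>

definition cover_of :: "('d \<Rightarrow> real) \<Rightarrow> 'd \<Rightarrow> bool \<Rightarrow> real" where
  "cover_of \<Lambda> i j = (if j then \<Lambda> i else 0)"

definition matrix_of :: "('d::finite \<Rightarrow> real) \<Rightarrow> 'd matrix" where
  "matrix_of \<Lambda> \<alpha> \<longleftrightarrow> 1 \<le> (\<Sum>i | \<alpha> i. \<Lambda> i)"

text \<open>
  The diversity of an extremal matrix is read off from a tuple of positive essential weights
  that forms its optimal cover; it is therefore a function of that tuple.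
\<close>

definition diversity :: "('d::finite \<Rightarrow> real) \<Rightarrow> nat" where
  "diversity \<Lambda> = card (range \<Lambda>)"

end

theory Submission
  imports Defs
begin

text \<open>
  If all weights are equal, the support of the matrix consists of the indices with at least
  \<open>k\<close> ones for some \<open>k \<ge> 1\<close>. A polydiagonal has total weight 2, and its weighted number of ones
  is the dimension \<open>d\<close>. If \<open>2k \<le> d\<close>, spreading weight 1 uniformly over the \<open>k\<close>-subsets and
  weight 1 over their complements gives a polydiagonal. If one index with \<open>k - 1\<close> ones is added,
  it receives weight at most 1, so a polydiagonal requires \<open>2k - 1 \<le> d\<close>. Hence \<open>d = 2k - 1\<close>, and
  optimality forces the common weight \<open>1/k\<close>.

  Conversely, for \<open>d = 2k - 1\<close> and an added index \<open>\<beta>\<close> with \<open>b < k\<close> ones, put \<open>m = k - b\<close>; weight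
  \<open>1/m\<close> on \<open>\<beta>\<close>, weight \<open>(m - 1)/m\<close> spread uniformly over the \<open>k\<close>-sets containing \<open>\<beta>\<close>, and weight 1
  spread uniformly over the \<open>k\<close>-sets disjoint from \<open>\<beta>\<close> form a polydiagonal. Optimality of the cover
  follows by duality from the uniform weighting of the \<open>k\<close>-sets.
\<close>

section \<open>Uniform weightings of the subsets of a fixed size\<close>

text \<open>The value 0 off the \<open>r\<close>-subsets of \<open>B\<close> lets all later sums
  range over all sets, filtered only by a membership condition.\<close>

definition uniform_subsets :: "'a set \<Rightarrow> nat \<Rightarrow> 'a set \<Rightarrow> real" where
  "uniform_subsets B r S = (if S \<subseteq> B \<and> card S = r then 1 / real (card B choose r) else 0)"

lemma uniform_subsets_nonneg: "0 \<le> uniform_subsets B r S"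
  by (simp add: uniform_subsets_def)

lemma sum_uniform_subsets_filter:
  fixes B :: "'a::finite set"
  shows "(\<Sum>S | P S. uniform_subsets B r S)
    = real (card {S. S \<subseteq> B \<and> card S = r \<and> P S}) / real (card B choose r)"
proof -
  have "(\<Sum>S | P S. uniform_subsets B r S)
    = (\<Sum>S | S \<subseteq> B \<and> card S = r \<and> P S. 1 / real (card B choose r))"
    by (intro sum.mono_neutral_cong_right) (auto simp: uniform_subsets_def)
  then show ?thesis by simp
qed

lemma sum_uniform_subsets:
  fixes B :: "'a::finite set"
  assumes "r \<le> card B"
  shows "(\<Sum>S\<in>UNIV. uniform_subsets B r S) = 1"
  using sum_uniform_subsets_filter[of B r "\<lambda>_. True"] n_subsets[of B r] assms by simp

text \<open>The \<open>r\<close>-subsets of \<open>B\<close> missing \<open>i\<close> are the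
  \<open>r\<close>-subsets of \<open>B - {i}\<close>; for \<open>i\<close> in \<open>B\<close>,
  absorption turns the quotient of binomials into \<open>(card B - r) / card B\<close>.\<close>

lemma sum_uniform_subsets_notin:
  fixes B :: "'a::finite set"
  assumes r: "r \<le> card B"
  shows "(\<Sum>S | i \<notin> S. uniform_subsets B r S) = (if i \<in> B then 1 - real r / real (card B) else 1)"
proof -
  have "{S. S \<subseteq> B \<and> card S = r \<and> i \<notin> S} = {S. S \<subseteq> B - {i} \<and> card S = r}" by auto
  then have sum_eq: "(\<Sum>S | i \<notin> S. uniform_subsets B r S)
    = real (card (B - {i}) choose r) / real (card B choose r)"
    using sum_uniform_subsets_filter[of B r "\<lambda>S. i \<notin> S"] n_subsets[of "B - {i}" r] by simp
  show ?thesis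
  proof (cases "i \<in> B")
    case True
    then have pos: "0 < card B" by (auto simp: card_gt_0_iff)
    have "real (card B - r) * real (card B choose r) = real (card B) * real ((card B - 1) choose r)"
      using binomial_absorb_comp[of "card B" r] by (metis of_nat_mult)
    moreover have "0 < card B choose r" using r by simp
    ultimately have "real ((card B - 1) choose r) / real (card B choose r)
      = real (card B - r) / real (card B)"
      using pos by (subst frac_eq_eq) (auto simp: mult.commute)
    then show ?thesis
      using True pos r sum_eq by (auto simp: diff_divide_distrib of_nat_diff)
  qed (use r sum_eq in simp)
qed

lemma sum_split_mem:
  fixes g :: "'a::finite set \<Rightarrow> real"
  shows "(\<Sum>S\<in>UNIV. g S) = (\<Sum>S | i \<in> S. g S) + (\<Sum>S | i \<notin> S. g S)"
proof -
  have "(UNIV :: 'a set set) = {S. i \<in> S} \<union> {S. i \<notin> S}" by auto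
  then show ?thesis by (metis (mono_tags, lifting) sum.union_disjoint finite disjoint_iff mem_Collect_eq)
qed

lemma sum_uniform_subsets_in:
  fixes B :: "'a::finite set"
  assumes "r \<le> card B"
  shows "(\<Sum>S | i \<in> S. uniform_subsets B r S) = (if i \<in> B then real r / real (card B) else 0)"
  using sum_split_mem[of "uniform_subsets B r" i] sum_uniform_subsets[OF assms]
    sum_uniform_subsets_notin[OF assms, of i] by (auto split: if_splits)

section \<open>Polydiagonals as weightings of sets\<close>

lemma sum_Compl_reindex:
  fixes g :: "'a::finite set \<Rightarrow> real"
  shows "(\<Sum>S | P (- S). g (- S)) = (\<Sum>S | P S. g S)"
  by (rule sum.reindex_bij_witness[of _ uminus uminus]) auto

lemma sum_Collect_reindex:
  fixes g :: "'a::finite set \<Rightarrow> real"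
  shows "(\<Sum>\<alpha> | P (Collect \<alpha>). g (Collect \<alpha>)) = (\<Sum>S | P S. g S)"
  by (rule sum.reindex_bij_witness[of _ "\<lambda>S x. x \<in> S" Collect]) auto

lemma sum_index_split:
  fixes w :: "'d::finite index \<Rightarrow> real"
  shows "(\<Sum>\<alpha>\<in>UNIV. w \<alpha>) = (\<Sum>\<alpha>\<in>hyperplane i True. w \<alpha>) + (\<Sum>\<alpha>\<in>hyperplane i False. w \<alpha>)"
proof -
  have "(UNIV :: 'd index set) = hyperplane i True \<union> hyperplane i False"
    by (auto simp: hyperplane_def)
  moreover have "hyperplane i True \<inter> hyperplane i False = {}"
    by (auto simp: hyperplane_def)
  ultimately show ?thesis by (metis sum.union_disjoint finite)
qed

lemma card_Compl:
  fixes S :: "'a::finite set"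
  shows "card (- S) = CARD('a) - card S"
  by (simp add: Compl_eq_Diff_UNIV card_Diff_subset)

text \<open>An index is identified with the set of its ones. Total weight 2 and weight 1 on
  \<open>hyperplane i True\<close> leave weight 1 for the parallel hyperplane, so only memberships
  need checking.\<close>

lemma polydiagonal_of_set_weights:
  fixes g :: "'d::finite set \<Rightarrow> real"
  assumes "\<And>S. 0 \<le> g S"
    and "\<And>\<alpha>. \<alpha> \<notin> support A \<Longrightarrow> g (Collect \<alpha>) = 0"
    and total: "(\<Sum>S\<in>UNIV. g S) = 2"
    and "\<And>i. (\<Sum>S | i \<in> S. g S) = 1"
  shows "polydiagonal A (\<lambda>\<alpha>. g (Collect \<alpha>))"
proof -
  have "(\<Sum>\<alpha>\<in>UNIV. g (Collect \<alpha>)) = 2"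
    using sum_Collect_reindex[of g "\<lambda>_. True"] total by simp
  moreover have T: "(\<Sum>\<alpha>\<in>hyperplane i True. g (Collect \<alpha>)) = 1" for i
    using sum_Collect_reindex[of g "\<lambda>S. i \<in> S"] assms(4)[of i] by (simp add: hyperplane_def)
  ultimately have F: "(\<Sum>\<alpha>\<in>hyperplane i False. g (Collect \<alpha>)) = 1" for i
    using sum_index_split[of "\<lambda>\<alpha>. g (Collect \<alpha>)" i] by simp
  have "(\<Sum>\<alpha>\<in>hyperplane i j. g (Collect \<alpha>)) = 1" for i j
    using T F by (cases j) auto
  then show ?thesis
    using assms(1,2) by (auto simp: polydiagonal_def)
qed

section \<open>Counting ones in a polydiagonal\<close>

lemma polydiagonal_total:
  fixes w :: "'d::finite index \<Rightarrow> real"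
  assumes "polydiagonal A w"
  shows "(\<Sum>\<alpha>\<in>UNIV. w \<alpha>) = 2"
  \<comment> \<open>Any direction serves here; \<open>undefined\<close> names one, since types are
    nonempty.\<close>
  using assms sum_index_split[of w undefined] by (simp add: polydiagonal_def)

text \<open>Double counting of the pairs of an index and a direction where it has a one: each
  direction contributes the weight 1 of its hyperplane.\<close>

lemma polydiagonal_count:
  fixes w :: "'d::finite index \<Rightarrow> real"
  assumes "polydiagonal A w"
  shows "(\<Sum>\<alpha>\<in>UNIV. w \<alpha> * real (card (Collect \<alpha>))) = real CARD('d)"
proof -
  have "(\<Sum>\<alpha>\<in>UNIV. w \<alpha> * real (card (Collect \<alpha>))) = (\<Sum>\<alpha>\<in>UNIV. \<Sum>i | \<alpha> i. w \<alpha>)"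
    by (simp add: mult.commute)
  also have "\<dots> = (\<Sum>i\<in>UNIV. \<Sum>\<alpha> | \<alpha> i. w \<alpha>)"
    using sum.swap_restrict[of "UNIV :: 'd index set" "UNIV :: 'd set" "\<lambda>\<alpha> i. w \<alpha>" "\<lambda>\<alpha> i. \<alpha> i"]
    by simp
  also have "\<dots> = (\<Sum>i\<in>(UNIV :: 'd set). 1)"
  proof (rule sum.cong[OF refl])
    fix i
    have "(\<Sum>\<alpha>\<in>hyperplane i True. w \<alpha>) = 1" using assms by (simp add: polydiagonal_def)
    then show "(\<Sum>\<alpha> | \<alpha> i. w \<alpha>) = 1" by (simp add: hyperplane_def)
  qed
  also have "\<dots> = real CARD('d)" by simp
  finally show ?thesis .
qed

lemma polydiagonal_weight_le_1:
  fixes w :: "'d::finite index \<Rightarrow> real"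
  assumes "polydiagonal A w"
  shows "w \<beta> \<le> 1"
proof -
  have "w \<beta> \<le> (\<Sum>\<alpha>\<in>hyperplane undefined (\<beta> undefined). w \<alpha>)"
    using assms by (intro member_le_sum) (auto simp: polydiagonal_def hyperplane_def)
  then show ?thesis using assms by (simp add: polydiagonal_def)
qed

text \<open>Total weight 2 on indices with at least \<open>k\<close> ones would give a weighted
  count of at least \<open>2 * k\<close>, but that count is the dimension.\<close>

lemma no_polydiagonal_if_many_ones:
  fixes A :: "'d::finite matrix"
  assumes many: "\<And>\<alpha>. \<alpha> \<in> support A \<Longrightarrow> k \<le> card (Collect \<alpha>)" and k: "CARD('d) < 2 * k"
  shows "\<not> polydiagonal A w"
proof
  assume w: "polydiagonal A w"
  have "(\<Sum>\<alpha>\<in>UNIV. w \<alpha> * real k) \<le> (\<Sum>\<alpha>\<in>UNIV. w \<alpha> * real (card (Collect \<alpha>)))"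
  proof (rule sum_mono)
    fix \<alpha> :: "'d index"
    show "w \<alpha> * real k \<le> w \<alpha> * real (card (Collect \<alpha>))"
      using w many[of \<alpha>] by (cases "\<alpha> \<in> support A") (auto simp: polydiagonal_def intro: mult_left_mono)
  qed
  then have "2 * real k \<le> real CARD('d)"
    using polydiagonal_total[OF w] polydiagonal_count[OF w] by (simp flip: sum_distrib_right)
  then show False using k by linarith
qed

lemma polydiagonal_added_index:
  fixes A :: "'d::finite matrix"
  assumes w: "polydiagonal (A(\<beta> := True)) w"
    and many: "\<And>\<alpha>. \<alpha> \<in> support A \<Longrightarrow> Suc (card (Collect \<beta>)) \<le> card (Collect \<alpha>)"
  shows "2 * card (Collect \<beta>) + 1 \<le> CARD('d)"
proof -
  let ?m = "real (card (Collect \<beta>)) + 1"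
  \<comment> \<open>Only \<open>\<beta>\<close> falls short of \<open>?m\<close> ones, and by
    exactly one, so subtracting \<open>w \<beta>\<close> once repairs the termwise bound.\<close>
  have "(\<Sum>\<alpha>\<in>UNIV. w \<alpha> * ?m - (if \<alpha> = \<beta> then w \<beta> else 0))
      \<le> (\<Sum>\<alpha>\<in>UNIV. w \<alpha> * real (card (Collect \<alpha>)))"
  proof (rule sum_mono)
    fix \<alpha> :: "'d index"
    show "w \<alpha> * ?m - (if \<alpha> = \<beta> then w \<beta> else 0) \<le> w \<alpha> * real (card (Collect \<alpha>))"
    proof (cases "\<alpha> = \<beta>")
      case True
      then show ?thesis by (simp add: algebra_simps)
    next
      case False
      show ?thesis
      proof (cases "\<alpha> \<in> support A")
        case True
        then have "?m \<le> real (card (Collect \<alpha>))" using many[of \<alpha>] by linarith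
        with False w show ?thesis by (auto simp: polydiagonal_def intro: mult_left_mono)
      next
        case notin: False
        with False w have "w \<alpha> = 0" by (auto simp: polydiagonal_def support_def)
        with False show ?thesis by simp
      qed
    qed
  qed
  then have "2 * ?m - w \<beta> \<le> real CARD('d)"
    using polydiagonal_total[OF w] polydiagonal_count[OF w]
    by (simp add: sum_subtractf flip: sum_distrib_right)
  then have "real (2 * card (Collect \<beta>) + 1) \<le> real CARD('d)"
    using polydiagonal_weight_le_1[OF w, of \<beta>] by simp
  then show ?thesis by (simp only: of_nat_le_iff)
qed

section \<open>Constructions of polydiagonals\<close>

lemma polydiagonal_if_few_ones:
  fixes A :: "'d::finite matrix"
  assumes supp: "\<And>\<alpha>. k \<le> card (Collect \<alpha>) \<Longrightarrow> \<alpha> \<in> support A" and k: "2 * k \<le> CARD('d)"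
  shows "\<exists>w. polydiagonal A w"
proof -
  let ?u = "uniform_subsets (UNIV :: 'd set) k"
  let ?g = "\<lambda>S. ?u S + ?u (- S)"
  have "polydiagonal A (\<lambda>\<alpha>. ?g (Collect \<alpha>))"
  proof (rule polydiagonal_of_set_weights)
    fix \<alpha> :: "'d index" assume "\<alpha> \<notin> support A"
    then have "card (Collect \<alpha>) < k" using supp[of \<alpha>] by force
    \<comment> \<open>Complements of \<open>k\<close>-sets have \<open>CARD('d) - k \<ge> k\<close>
      elements, so they lie in the support as well.\<close>
    then show "?g (Collect \<alpha>) = 0"
      using k by (auto simp: uniform_subsets_def card_Compl simp del: Collect_neg_eq)
  next
    show "(\<Sum>S\<in>UNIV. ?g S) = 2"
      using sum_Compl_reindex[of ?u "\<lambda>_. True"] sum_uniform_subsets[of k "UNIV :: 'd set"] k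
      by (simp add: sum.distrib)
  next
    fix i :: 'd
    show "(\<Sum>S | i \<in> S. ?g S) = 1"
      \<comment> \<open>Exactly one of a set and its complement contains \<open>i\<close>, so the
        two summands together contribute the full weight 1.\<close>
      using sum_Compl_reindex[of ?u "\<lambda>S. i \<notin> S"] sum_split_mem[of ?u i]
        sum_uniform_subsets[of k "UNIV :: 'd set"] k
      by (simp add: sum.distrib)
  qed (simp add: uniform_subsets_nonneg)
  then show ?thesis by blast
qed

lemma polydiagonal_adding_index:
  fixes A :: "'d::finite matrix"
  assumes supp: "\<And>\<alpha>. k \<le> card (Collect \<alpha>) \<Longrightarrow> \<alpha> \<in> support A"
    and d: "CARD('d) + 1 = 2 * k" and b: "card (Collect \<beta>) < k"
  shows "\<exists>w. polydiagonal (A(\<beta> := True)) w"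
proof -
  define B where "B = - Collect \<beta>"
  define m where "m = k - card (Collect \<beta>)"
  have m: "0 < m" "m \<le> k" using b by (auto simp: m_def)
  have cB: "card B = k + m - 1"
    using d b by (simp add: B_def card_Compl m_def del: Collect_neg_eq)
  have rB: "k \<le> card B" "k - 1 \<le> card B" using cB m by auto
  have memB: "i \<in> B \<longleftrightarrow> \<not> \<beta> i" for i by (simp add: B_def)
  \<comment> \<open>The complements of the \<open>(k-1)\<close>-subsets of \<open>B\<close> are the \<open>k\<close>-sets containing \<open>\<beta>\<close>.\<close>
  let ?g = "\<lambda>S. (if S = Collect \<beta> then 1 / real m else 0)
    + (real m - 1) / real m * uniform_subsets B (k - 1) (- S) + uniform_subsets B k S"
  have "polydiagonal (A(\<beta> := True)) (\<lambda>\<alpha>. ?g (Collect \<alpha>))"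
  proof (rule polydiagonal_of_set_weights)
    fix S
    show "0 \<le> ?g S" using m(1) by (simp add: uniform_subsets_nonneg)
  next
    fix \<alpha> assume "\<alpha> \<notin> support (A(\<beta> := True))"
    then have ne: "\<alpha> \<noteq> \<beta>" and "\<alpha> \<notin> support A" by (auto simp: support_def split: if_splits)
    then have lt: "card (Collect \<alpha>) < k" using supp[of \<alpha>] by force
    \<comment> \<open>In dimension \<open>2 * k - 1\<close>, fewer than \<open>k\<close> ones means
      at least \<open>k\<close> zeros.\<close>
    moreover have "card (- Collect \<alpha>) \<noteq> k - 1"
      using lt d by (simp add: card_Compl del: Collect_neg_eq)
    moreover have "Collect \<alpha> \<noteq> Collect \<beta>" using ne by (metis Collect_inj)
    ultimately show "?g (Collect \<alpha>) = 0"
      by (simp add: uniform_subsets_def del: Collect_neg_eq)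
  next
    have "(\<Sum>S\<in>UNIV. ?g S) = 1 / real m + (real m - 1) / real m + 1"
      using sum_Compl_reindex[of "uniform_subsets B (k - 1)" "\<lambda>_. True"]
        sum_uniform_subsets[OF rB(1)] sum_uniform_subsets[OF rB(2)]
      by (simp add: sum.distrib flip: sum_distrib_left sum_divide_distrib)
    then show "(\<Sum>S\<in>UNIV. ?g S) = 2" using m(1) by (simp add: field_simps)
  next
    fix i
    have "(\<Sum>S | i \<in> S. ?g S) = (if i \<in> B then 0 else 1 / real m)
      + (real m - 1) / real m * (if i \<in> B then 1 - real (k - 1) / real (card B) else 1)
      + (if i \<in> B then real k / real (card B) else 0)"
      using sum_Compl_reindex[of "uniform_subsets B (k - 1)" "\<lambda>S. i \<notin> S"]
        sum_uniform_subsets_in[OF rB(1), of i] sum_uniform_subsets_notin[OF rB(2), of i]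
      by (simp add: sum.distrib memB del: One_nat_def flip: sum_distrib_left sum_divide_distrib)
    \<comment> \<open>Outside \<open>B\<close> the sum is \<open>1/m + (m - 1)/m\<close>; inside
      \<open>B\<close> it is \<open>(m - 1)/(k + m - 1) + k/(k + m - 1)\<close>.\<close>
    also have "\<dots> = 1"
    proof (cases "i \<in> B")
      case True
      have "real (k - 1) = real k - 1" "real (card B) = real k + real m - 1" "0 < real k + real m - 1"
        using m cB by (auto simp: of_nat_diff)
      then show ?thesis using True m(1) by (simp add: divide_simps)
    qed (use m(1) in \<open>simp add: field_simps\<close>)
    finally show "(\<Sum>S | i \<in> S. ?g S) = 1" .
  qed
  then show ?thesis by blast
qed

section \<open>Covers and weak duality\<close>

lemma sum_hyperplanes_through:
  fixes L :: "'d::finite \<Rightarrow> bool \<Rightarrow> real"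
  shows "(\<Sum>(i, j)\<in>{(i, j). \<alpha> \<in> hyperplane i j}. L i j) = (\<Sum>i\<in>UNIV. L i (\<alpha> i))"
  by (rule sum.reindex_bij_witness[of _ "\<lambda>i. (i, \<alpha> i)" fst]) (auto simp: hyperplane_def)

text \<open>Weak linear programming duality: \<open>w\<close> is feasible for the packing problem
  dual to covering. The weighted sum of the covering inequalities is regrouped by hyperplanes, where
  the packing bounds apply.\<close>

lemma cover_weight_ge_packing:
  fixes w :: "'d::finite index \<Rightarrow> real"
  assumes L: "hyperplane_cover A L"
    and w: "\<And>\<alpha>. 0 \<le> w \<alpha>" "\<And>\<alpha>. \<alpha> \<notin> support A \<Longrightarrow> w \<alpha> = 0"
    and le: "\<And>i j. (\<Sum>\<alpha>\<in>hyperplane i j. w \<alpha>) \<le> 1"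
  shows "(\<Sum>\<alpha>\<in>UNIV. w \<alpha>) \<le> cover_weight L"
proof -
  have "(\<Sum>\<alpha>\<in>UNIV. w \<alpha>) \<le> (\<Sum>\<alpha>\<in>UNIV. w \<alpha> * (\<Sum>i\<in>UNIV. L i (\<alpha> i)))"
  proof (rule sum_mono)
    fix \<alpha>
    show "w \<alpha> \<le> w \<alpha> * (\<Sum>i\<in>UNIV. L i (\<alpha> i))"
    proof (cases "\<alpha> \<in> support A")
      case True
      then have "1 \<le> (\<Sum>i\<in>UNIV. L i (\<alpha> i))"
        using L by (simp add: hyperplane_cover_def sum_hyperplanes_through)
      then show ?thesis using mult_left_mono[OF _ w(1)] by fastforce
    qed (simp add: w(2))
  qed
  also have "\<dots> = (\<Sum>i\<in>UNIV. \<Sum>\<alpha>\<in>UNIV. w \<alpha> * L i (\<alpha> i))"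
    unfolding sum_distrib_left by (rule sum.swap)
  also have "\<dots> = (\<Sum>i\<in>UNIV. \<Sum>j\<in>UNIV. (\<Sum>\<alpha>\<in>hyperplane i j. w \<alpha>) * L i j)"
  proof (rule sum.cong[OF refl])
    fix i
    have "(\<Sum>\<alpha>\<in>hyperplane i j. w \<alpha> * L i (\<alpha> i)) = (\<Sum>\<alpha>\<in>hyperplane i j. w \<alpha>) * L i j" for j
      unfolding sum_distrib_right by (rule sum.cong) (auto simp: hyperplane_def)
    then show "(\<Sum>\<alpha>\<in>UNIV. w \<alpha> * L i (\<alpha> i)) = (\<Sum>j\<in>UNIV. (\<Sum>\<alpha>\<in>hyperplane i j. w \<alpha>) * L i j)"
      using sum_index_split[of "\<lambda>\<alpha>. w \<alpha> * L i (\<alpha> i)" i] by (simp add: UNIV_bool)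
  qed
  also have "\<dots> \<le> (\<Sum>i\<in>UNIV. \<Sum>j\<in>UNIV. 1 * L i j)"
    using L le by (intro sum_mono mult_right_mono) (auto simp: hyperplane_cover_def)
  finally show ?thesis by (simp add: cover_weight_def)
qed

lemma cover_weight_cover_of: "cover_weight (cover_of \<Lambda>) = (\<Sum>i\<in>UNIV. \<Lambda> i)"
  by (simp add: cover_weight_def cover_of_def UNIV_bool)

lemma hyperplane_cover_cover_of:
  fixes \<Lambda> :: "'d::finite \<Rightarrow> real"
  shows "hyperplane_cover A (cover_of \<Lambda>) \<longleftrightarrow>
    (\<forall>i. 0 \<le> \<Lambda> i) \<and> (\<forall>\<alpha>\<in>support A. 1 \<le> (\<Sum>i | \<alpha> i. \<Lambda> i))"
proof -
  have "(\<Sum>i\<in>UNIV. cover_of \<Lambda> i (\<alpha> i)) = (\<Sum>i | \<alpha> i. \<Lambda> i)" for \<alpha>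
    by (simp add: cover_of_def sum.If_cases)
  moreover have "(\<forall>i j. 0 \<le> cover_of \<Lambda> i j) \<longleftrightarrow> (\<forall>i. 0 \<le> \<Lambda> i)"
    by (simp add: cover_of_def all_bool_eq)
  ultimately show ?thesis
    by (simp add: hyperplane_cover_def sum_hyperplanes_through)
qed

section \<open>Threshold matrices from constant weights\<close>

lemma matrix_of_const_iff:
  fixes \<Lambda> :: "'d::finite \<Rightarrow> real"
  assumes "\<And>i. \<Lambda> i = c" "0 < c"
  shows "\<alpha> \<in> support (matrix_of \<Lambda>) \<longleftrightarrow> nat \<lceil>1 / c\<rceil> \<le> card (Collect \<alpha>)"
proof -
  have "1 \<le> real (card (Collect \<alpha>)) * c \<longleftrightarrow> 1 / c \<le> real (card (Collect \<alpha>))"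
    using assms(2) by (simp add: field_simps)
  also have "\<dots> \<longleftrightarrow> nat \<lceil>1 / c\<rceil> \<le> card (Collect \<alpha>)"
    by linarith
  finally show ?thesis by (simp add: support_def matrix_of_def assms(1))
qed

lemma optimal_cover_const:
  fixes A :: "'d::finite matrix"
  assumes supp: "\<And>\<alpha>. \<alpha> \<in> support A \<longleftrightarrow> k \<le> card (Collect \<alpha>)"
    and k: "0 < k" "k \<le> CARD('d)" "CARD('d) \<le> 2 * k"
  shows "optimal_cover A (cover_of (\<lambda>_. 1 / real k))"
  unfolding optimal_cover_def
proof (intro conjI allI impI)
  show "hyperplane_cover A (cover_of (\<lambda>_. 1 / real k))"
    using k(1) by (auto simp: hyperplane_cover_cover_of supp)
next
  fix L assume L: "hyperplane_cover A L"
  \<comment> \<open>The factor normalises each \<open>hyperplane i True\<close> to weight 1 and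
    equals the weight of the cover. The parallel hyperplane receives \<open>?c - 1\<close>, which is
    at most 1 because \<open>CARD('d) \<le> 2 * k\<close>.\<close>
  let ?c = "real CARD('d) / real k"
  let ?u = "uniform_subsets (UNIV :: 'd set) k"
  let ?w = "\<lambda>\<alpha>. ?c * ?u (Collect \<alpha>)"
  have total: "(\<Sum>\<alpha>\<in>UNIV. ?w \<alpha>) = ?c"
    using sum_Collect_reindex[of ?u "\<lambda>_. True"] sum_uniform_subsets[of k "UNIV :: 'd set"] k(2)
    by (simp flip: sum_distrib_left sum_divide_distrib)
  have T: "(\<Sum>\<alpha>\<in>hyperplane i True. ?w \<alpha>) = 1" for i
    using sum_Collect_reindex[of ?u "\<lambda>S. i \<in> S"] sum_uniform_subsets_in[of k "UNIV :: 'd set" i] k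
    by (simp add: hyperplane_def flip: sum_distrib_left sum_divide_distrib)
  have "?c \<le> 2" using k(1,3) by (simp add: field_simps)
  then have F: "(\<Sum>\<alpha>\<in>hyperplane i False. ?w \<alpha>) \<le> 1" for i
    using sum_index_split[of ?w i] T[of i] total by linarith
  have "(\<Sum>\<alpha>\<in>UNIV. ?w \<alpha>) \<le> cover_weight L"
  proof (rule cover_weight_ge_packing[OF L])
    show "(\<Sum>\<alpha>\<in>hyperplane i j. ?w \<alpha>) \<le> 1" for i j
      using T[of i] F[of i] by (cases j) auto
  qed (auto simp: uniform_subsets_nonneg, auto simp: uniform_subsets_def supp)
  then show "cover_weight (cover_of (\<lambda>_::'d. 1 / real k)) \<le> cover_weight L"
    using total by (simp add: cover_weight_cover_of)
qed

lemma extremal_threshold_iff: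
  fixes A :: "'d::finite matrix"
  assumes supp: "\<And>\<alpha>. \<alpha> \<in> support A \<longleftrightarrow> k \<le> card (Collect \<alpha>)" and k: "0 < k"
  shows "extremal A \<longleftrightarrow> CARD('d) + 1 = 2 * k"
proof
  assume ext: "extremal A"
  have gt: "CARD('d) < 2 * k"
    using ext polydiagonal_if_few_ones[of k A] supp by (force simp: extremal_def)
  \<comment> \<open>The minimum covers the case of an empty support.\<close>
  define r where "r = min (k - 1) CARD('d)"
  obtain R :: "'d set" where R: "card R = r"
    using obtain_subset_with_card_n[of r "UNIV :: 'd set"] by (auto simp: r_def)
  define \<beta> where "\<beta> = (\<lambda>i. i \<in> R)"
  have card_beta: "card (Collect \<beta>) = r" by (simp add: \<beta>_def R)
  then have "\<beta> \<notin> support A" using k by (auto simp: supp r_def)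
  then obtain w where w: "polydiagonal (A(\<beta> := True)) w"
    using ext by (auto simp: extremal_def)
  have "2 * card (Collect \<beta>) + 1 \<le> CARD('d)"
  proof (rule polydiagonal_added_index[OF w])
    fix \<alpha> assume "\<alpha> \<in> support A"
    then show "Suc (card (Collect \<beta>)) \<le> card (Collect \<alpha>)"
      using k by (simp add: supp card_beta r_def)
  qed
  \<comment> \<open>The case \<open>r = CARD('d)\<close> contradicts the inequality just shown.
    Hence \<open>r = k - 1\<close>, so \<open>2 * k - 1 \<le> CARD('d) < 2 * k\<close>.\<close>
  then show "CARD('d) + 1 = 2 * k"
    using gt by (auto simp: card_beta r_def min_def split: if_splits)
next
  assume d: "CARD('d) + 1 = 2 * k"
  show "extremal A"
    unfolding extremal_def
  proof (intro conjI allI impI)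
    show "\<nexists>w. polydiagonal A w"
      using no_polydiagonal_if_many_ones[of A k] supp d by auto
    show "\<exists>w. polydiagonal (A(\<beta> := True)) w" if "\<beta> \<notin> support A" for \<beta>
      using polydiagonal_adding_index[of k A \<beta>] supp d that by auto
  qed
qed

theorem proposition17:
  fixes \<Lambda> :: "'d::finite \<Rightarrow> real"
  assumes "\<And>i. 0 < \<Lambda> i"
  shows "(extremal (matrix_of \<Lambda>) \<and> optimal_cover (matrix_of \<Lambda>) (cover_of \<Lambda>) \<and> diversity \<Lambda> = 1)
    \<longleftrightarrow> (odd CARD('d) \<and> (\<forall>i. \<Lambda> i = 2 / (real CARD('d) + 1)))"
proof
  assume lhs: "extremal (matrix_of \<Lambda>) \<and> optimal_cover (matrix_of \<Lambda>) (cover_of \<Lambda>) \<and> diversity \<Lambda> = 1"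
  then obtain c where "range \<Lambda> = {c}"
    by (auto simp: diversity_def card_1_singleton_iff)
  then have c: "\<And>i. \<Lambda> i = c" by auto
  with assms have c_pos: "0 < c" by metis
  define k where "k = nat \<lceil>1 / c\<rceil>"
  have supp: "\<alpha> \<in> support (matrix_of \<Lambda>) \<longleftrightarrow> k \<le> card (Collect \<alpha>)" for \<alpha>
    unfolding k_def by (rule matrix_of_const_iff[OF c c_pos])
  have k: "0 < k" using c_pos by (simp add: k_def)
  have d: "CARD('d) + 1 = 2 * k"
    using lhs extremal_threshold_iff[OF supp k] by blast
  \<comment> \<open>The competitor with constant weight \<open>1 / k\<close> covers the same matrix,
    so optimality gives \<open>c \<le> 1 / k\<close>; rounding up in the definition of
    \<open>k\<close> gives the reverse inequality.\<close>
  have "hyperplane_cover (matrix_of \<Lambda>) (cover_of (\<lambda>_. 1 / real k))"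
    using k by (auto simp: hyperplane_cover_cover_of supp)
  then have "cover_weight (cover_of \<Lambda>) \<le> cover_weight (cover_of (\<lambda>_::'d. 1 / real k))"
    using lhs unfolding optimal_cover_def by blast
  then have "real CARD('d) * c \<le> real CARD('d) * (1 / real k)"
    by (simp add: cover_weight_cover_of c)
  then have "c \<le> 1 / real k"
    by (subst (asm) mult_le_cancel_left_pos) auto
  moreover have "1 / c \<le> real k" unfolding k_def by linarith
  then have "1 / real k \<le> c" using k c_pos by (simp add: field_simps)
  ultimately have "c = 1 / real k" by simp
  moreover have "real CARD('d) + 1 = 2 * real k" using d by linarith
  ultimately have "c = 2 / (real CARD('d) + 1)" by simp
  moreover have "odd CARD('d)" using d by presburger
  ultimately show "odd CARD('d) \<and> (\<forall>i. \<Lambda> i = 2 / (real CARD('d) + 1))"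
    using c by simp
next
  assume rhs: "odd CARD('d) \<and> (\<forall>i. \<Lambda> i = 2 / (real CARD('d) + 1))"
  then obtain k where d: "CARD('d) + 1 = 2 * k"
    by (metis evenE odd_even_add odd_one)
  then have k: "0 < k" by (cases k) auto
  have "real CARD('d) + 1 = 2 * real k" using d by linarith
  then have \<Lambda>: "\<Lambda> = (\<lambda>_. 1 / real k)" using rhs by auto
  \<comment> \<open>For \<open>c = 1 / k\<close> the rounding is exact, so the threshold is
    \<open>k\<close> itself.\<close>
  have supp: "\<alpha> \<in> support (matrix_of \<Lambda>) \<longleftrightarrow> k \<le> card (Collect \<alpha>)" for \<alpha>
    using matrix_of_const_iff[of \<Lambda> "1 / real k" \<alpha>] k \<Lambda> by simp
  have "extremal (matrix_of \<Lambda>)"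
    using extremal_threshold_iff[OF supp k] d by blast
  moreover have "optimal_cover (matrix_of \<Lambda>) (cover_of \<Lambda>)"
    using optimal_cover_const[OF supp] k d by (simp add: \<Lambda>)
  moreover have "diversity \<Lambda> = 1"
    by (simp add: diversity_def \<Lambda>)
  ultimately show "extremal (matrix_of \<Lambda>) \<and> optimal_cover (matrix_of \<Lambda>) (cover_of \<Lambda>) \<and> diversity \<Lambda> = 1"
    by blast
qed

end
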